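(* Let $m \ge 1$ and let $\{\mathbf{x}_k\}$ and $\{\mathbf{y}_k\}$ be zero-mean, real-valued, $m$-dimensional, discrete-time stationary stochastic processes (not necessarily elliptical). Suppose that their distributions are $p_{\{\mathbf{x}_k\}}$ and $p_{\{\mathbf{y}_k\}}$, respectively, and that their power spectra are $\Phi_{\mathbf{x}}(\omega)$ and $\Phi_{\mathbf{y}}(\omega)$, respectively; all covariance matrices and power spectra are assumed to be positive definite. Then the average $\mathcal{W}_2$ distance between $p_{\{\mathbf{x}_k\}}$ and $p_{\{\mathbf{y}_k\}}$ is lower bounded by $$\mathcal{W}_2\left(p_{\{\mathbf{x}_k\}}; p_{\{\mathbf{y}_k\}}\right) \ge \sqrt{\frac{1}{2\pi}\int_0^{2\pi} \operatorname{tr}\left\{ W\left[\Phi_{\mathbf{x}}(\omega), \Phi_{\mathbf{y}}(\omega)\right]\right\}\, \mathrm{d}\omega},$$ where $$W\left[\Phi_{\mathbf{x}}(\omega), \Phi_{\mathbf{y}}(\omega)\right] = \Phi_{\mathbf{x}}(\omega) + \Phi_{\mathbf{y}}(\omega) - 2\left[\Phi_{\mathbf{x}}^{\frac12}(\omega)\,\Phi_{\mathbf{y}}(\omega)\,\Phi_{\mathbf{x}}^{\frac12}(\omega)\right]^{\frac12}.$$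
   Context: All random vectors are zero-mean, real-valued and continuous (they have probability densities), and processes are in discrete time, indexed by $k \in \mathbb{Z}$. For a process $\{\mathbf{x}_k\}$ with values in $\mathbb{R}^m$, $\mathbf{x}_{0,\ldots,i}$ denotes the $(i+1)m$-dimensional random vector $[\mathbf{x}_0^{\mathrm{T}},\ldots,\mathbf{x}_i^{\mathrm{T}}]^{\mathrm{T}}$. The covariance matrix of a random vector $\mathbf{x}$ is $\Sigma_{\mathbf{x}} = \mathbb{E}[\mathbf{x}\mathbf{x}^{\mathrm{T}}]$. Stationarity: $\{\mathbf{x}_k\}$ is stationary if its auto-correlation $R_{\mathbf{x}}(i,k) = \mathbb{E}[\mathbf{x}_i \mathbf{x}_{i+k}^{\mathrm{T}}]$ depends only on $k$; it is then written $R_{\mathbf{x}}(k)$. Power spectrum: for a stationary process, $\Phi_{\mathbf{x}}(\omega) = \sum_{k=-\infty}^{\infty} R_{\mathbf{x}}(k)\, \mathrm{e}^{-\mathrm{j}\omega k}$, where $\mathrm{j}$ is the imaginary unit; this is an $m\times m$ Hermitian matrix for each $\omega$. Standing assumption: all covariance matrices (in particular those of $\mathbf{x}_{0,\ldots,i}$ and $\mathbf{y}_{0,\ldots,i}$ for all $i$) and all power spectra are positive definite. For a positive definite matrix $A$, $A^{1/2}$ is its positive definite square root. Average $\mathcal{W}_2$ distance: for $m$-dimensional processes, $$\mathcal{W}_2\left(p_{\{\mathbf{x}_k\}}; p_{\{\mathbf{y}_k\}}\right) = \left(\inf_{\{\mathbf{x}_k\},\{\mathbf{y}_k\}} \limsup_{i\to\infty}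 \frac{\mathbb{E}\left[\|\mathbf{x}_{0,\ldots,i} - \mathbf{y}_{0,\ldots,i}\|^2\right]}{i+1}\right)^{\frac12},$$ where $\|\cdot\|$ is the Euclidean norm and the infimum is over all couplings, i.e. all pairs of processes $\{\mathbf{x}_k\}$, $\{\mathbf{y}_k\}$ defined jointly on a common probability space and having the distributions $p_{\{\mathbf{x}_k\}}$ and $p_{\{\mathbf{y}_k\}}$, respectively. *)

theory Defs
  imports "HOL-Probability.Probability"
begin

abbreviation path_space :: "(int \<Rightarrow> real ^ 'm) measure" where
  "path_space \<equiv> Pi\<^sub>M UNIV (\<lambda>_. borel)"

definition process :: "'a measure \<Rightarrow> (int \<Rightarrow> 'a \<Rightarrow> real ^ 'm) \<Rightarrow> bool" where
  "process M x \<longleftrightarrow> prob_space M \<and> (\<forall>k. x k \<in> borel_measurable M)"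

definition process_law ::
    "'a measure \<Rightarrow> (int \<Rightarrow> 'a \<Rightarrow> real ^ 'm) \<Rightarrow> (int \<Rightarrow> real ^ 'm) measure" where
  "process_law M x = distr M path_space (\<lambda>\<omega> k. x k \<omega>)"

text \<open>Square integrability is what makes all covariance matrices exist.\<close>

definition zero_mean_process :: "'a measure \<Rightarrow> (int \<Rightarrow> 'a \<Rightarrow> real ^ 'm) \<Rightarrow> bool" where
  "zero_mean_process M x \<longleftrightarrow> process M x \<and>
     (\<forall>k. integrable M (\<lambda>\<omega>. (norm (x k \<omega>))\<^sup>2)) \<and> (\<forall>k. integral\<^sup>L M (x k) = 0)"

text \<open>The random vector with blocks \<open>x 0, \<dots>, x i\<close> is represented by the restriction of the
  path to \<open>{0..i}\<close>; the product of Lebesgue measures over this index set plays the role of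
  Lebesgue measure on \<open>(i+1)m\<close>-dimensional space.\<close>

definition has_densities :: "'a measure \<Rightarrow> (int \<Rightarrow> 'a \<Rightarrow> real ^ 'm) \<Rightarrow> bool" where
  "has_densities M x \<longleftrightarrow>
     (\<forall>k. \<exists>f. distributed M lborel (x k) f) \<and>
     (\<forall>i::nat. \<exists>f. distributed M (Pi\<^sub>M {0..int i} (\<lambda>_. lborel))
                  (\<lambda>\<omega>. \<lambda>k\<in>{0..int i}. x k \<omega>) f)"

definition autocorr :: "'a measure \<Rightarrow> (int \<Rightarrow> 'a \<Rightarrow> real ^ 'm) \<Rightarrow> int \<Rightarrow> int \<Rightarrow> real ^ 'm ^ 'm" where
  "autocorr M x i k = (\<chi> a b. integral\<^sup>L M (\<lambda>\<omega>. x i \<omega> $ a * x (i + k) \<omega> $ b))"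

definition stationary :: "'a measure \<Rightarrow> (int \<Rightarrow> 'a \<Rightarrow> real ^ 'm) \<Rightarrow> bool" where
  "stationary M x \<longleftrightarrow> (\<forall>i i' k. autocorr M x i k = autocorr M x i' k)"

text \<open>Coordinates of the stacked vector with blocks \<open>x 0, \<dots>, x i\<close> are indexed by pairs of a time
  in \<open>{0..i}\<close> and a component.\<close>

definition stacked_cov ::
    "'a measure \<Rightarrow> (int \<Rightarrow> 'a \<Rightarrow> real ^ 'm) \<Rightarrow> int \<times> 'm \<Rightarrow> int \<times> 'm \<Rightarrow> real" where
  "stacked_cov M x = (\<lambda>(k, a) (l, b). integral\<^sup>L M (\<lambda>\<omega>. x k \<omega> $ a * x l \<omega> $ b))"

definition real_pos_def_on :: "'i set \<Rightarrow> ('i \<Rightarrow> 'i \<Rightarrow> real) \<Rightarrow> bool" where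
  "real_pos_def_on I A \<longleftrightarrow>
     (\<forall>p\<in>I. \<forall>q\<in>I. A p q = A q p) \<and>
     (\<forall>v. (\<exists>p\<in>I. v p \<noteq> 0) \<longrightarrow> (\<Sum>p\<in>I. \<Sum>q\<in>I. v p * A p q * v q) > 0)"

definition covs_pos_def :: "'a measure \<Rightarrow> (int \<Rightarrow> 'a \<Rightarrow> real ^ 'm) \<Rightarrow> bool" where
  "covs_pos_def M x \<longleftrightarrow> (\<forall>i::nat. real_pos_def_on ({0..int i} \<times> UNIV) (stacked_cov M x))"

definition hermitian_pos_def :: "complex ^ 'm ^ 'm \<Rightarrow> bool" where
  "hermitian_pos_def A \<longleftrightarrow>
     (\<forall>a b. A $ a $ b = cnj (A $ b $ a)) \<and>
     (\<forall>v. v \<noteq> 0 \<longrightarrow> Re (\<Sum>a\<in>UNIV. cnj (v $ a) * (A *v v) $ a) > 0)"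

text \<open>Only meaningful for positive definite \<open>A\<close>, where existence and uniqueness hold.\<close>

definition matrix_sqrt :: "complex ^ 'm ^ 'm \<Rightarrow> complex ^ 'm ^ 'm" where
  "matrix_sqrt A = (THE B. hermitian_pos_def B \<and> B ** B = A)"

text \<open>The bilateral series is understood as the pointwise limit of its symmetric partial sums, the
  weakest of the usual senses of convergence. For a stationary process the autocorrelation at
  lag \<open>k\<close> may be read off at time \<open>0\<close>.\<close>

definition has_power_spectrum ::
    "'a measure \<Rightarrow> (int \<Rightarrow> 'a \<Rightarrow> real ^ 'm) \<Rightarrow> (real \<Rightarrow> complex ^ 'm ^ 'm) \<Rightarrow> bool" where
  "has_power_spectrum M x \<Phi> \<longleftrightarrow>
     (\<forall>w. (\<lambda>n. \<Sum>k\<in>{- int n..int n}.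
             (\<chi> a b. complex_of_real (autocorr M x 0 k $ a $ b) *
                      exp (- \<i> * complex_of_real w * of_int k))) \<longlonglongrightarrow> \<Phi> w)"

definition W_mat :: "complex ^ 'm ^ 'm \<Rightarrow> complex ^ 'm ^ 'm \<Rightarrow> complex ^ 'm ^ 'm" where
  "W_mat A B = A + B - 2 *\<^sub>R matrix_sqrt (matrix_sqrt A ** B ** matrix_sqrt A)"

definition is_coupling ::
    "'c measure \<Rightarrow> (int \<Rightarrow> 'c \<Rightarrow> real ^ 'm) \<Rightarrow> (int \<Rightarrow> 'c \<Rightarrow> real ^ 'm) \<Rightarrow>
     (int \<Rightarrow> real ^ 'm) measure \<Rightarrow> (int \<Rightarrow> real ^ 'm) measure \<Rightarrow> bool" where
  "is_coupling Q X Y p q \<longleftrightarrow>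
     process Q X \<and> process Q Y \<and> process_law Q X = p \<and> process_law Q Y = q"

text \<open>The squared norm of a stacked vector is the sum of the squared norms of its blocks.\<close>

definition avg_cost ::
    "'c measure \<Rightarrow> (int \<Rightarrow> 'c \<Rightarrow> real ^ 'm) \<Rightarrow> (int \<Rightarrow> 'c \<Rightarrow> real ^ 'm) \<Rightarrow> ennreal" where
  "avg_cost Q X Y =
     limsup (\<lambda>i::nat. (\<integral>\<^sup>+ \<omega>. ennreal (\<Sum>k\<in>{0..int i}. (norm (X k \<omega> - Y k \<omega>))\<^sup>2) \<partial>Q) / of_nat (i + 1))"

definition sqrt_ennreal :: "ennreal \<Rightarrow> ennreal" where
  "sqrt_ennreal c = (if c = \<top> then \<top> else ennreal (sqrt (enn2real c)))"

text \<open>HOL cannot quantify over the types carrying a probability space inside a term, so the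
  infimum is taken over couplings carried by the canonical type of pairs of paths. The lemma
  \<open>avg_W2_le_coupling\<close> below shows that couplings on arbitrary types do not lower it.\<close>

definition avg_W2 ::
    "(int \<Rightarrow> real ^ 'm) measure \<Rightarrow> (int \<Rightarrow> real ^ 'm) measure \<Rightarrow> ennreal" where
  "avg_W2 p q = sqrt_ennreal
     (INF (Q, X, Y) \<in> {(Q :: ((int \<Rightarrow> real ^ 'm) \<times> (int \<Rightarrow> real ^ 'm)) measure, X, Y).
                        is_coupling Q X Y p q}. avg_cost Q X Y)"

lemma sqrt_ennreal_mono:
  assumes "a \<le> b" shows "sqrt_ennreal a \<le> sqrt_ennreal b"
proof (cases "b = \<top>")
  case False
  then have "enn2real a \<le> enn2real b"
    using assms by (intro enn2real_mono) (auto simp: top.not_eq_extremum)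
  then show ?thesis
    using assms False by (auto simp: sqrt_ennreal_def top_unique intro!: ennreal_leI)
qed (simp add: sqrt_ennreal_def)

lemma avg_W2_le_coupling:
  fixes Q :: "'c measure" and X Y :: "int \<Rightarrow> 'c \<Rightarrow> real ^ 'm"
  assumes "is_coupling Q X Y p q"
  shows "avg_W2 p q \<le> sqrt_ennreal (avg_cost Q X Y)"
proof -
  define J where "J = (\<lambda>\<omega>. (\<lambda>k. X k \<omega>, \<lambda>k. Y k \<omega>))"
  define P :: "((int \<Rightarrow> real ^ 'm) \<times> (int \<Rightarrow> real ^ 'm)) measure"
    where "P = path_space \<Otimes>\<^sub>M path_space"
  have X[measurable]: "\<And>k. X k \<in> borel_measurable Q"
    and Y[measurable]: "\<And>k. Y k \<in> borel_measurable Q"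
    and pr: "prob_space Q" and pq: "p = process_law Q X" "q = process_law Q Y"
    using assms by (auto simp: is_coupling_def process_def)
  have mX: "(\<lambda>\<omega> k. X k \<omega>) \<in> Q \<rightarrow>\<^sub>M path_space"
    using measurable_PiM_single'[of UNIV X Q "\<lambda>_. borel"] by simp
  have mY: "(\<lambda>\<omega> k. Y k \<omega>) \<in> Q \<rightarrow>\<^sub>M path_space"
    using measurable_PiM_single'[of UNIV Y Q "\<lambda>_. borel"] by simp
  have J: "J \<in> Q \<rightarrow>\<^sub>M P"
    unfolding J_def P_def using mX mY by measurable
  have c1: "(\<lambda>z. fst z k) \<in> borel_measurable P" and c2: "(\<lambda>z. snd z k) \<in> borel_measurable P" for k
    unfolding P_def by measurable
  have f1: "fst \<in> P \<rightarrow>\<^sub>M path_space" and f2: "snd \<in> P \<rightarrow>\<^sub>M path_space"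
    unfolding P_def by measurable
  let ?X = "\<lambda>k (z :: (int \<Rightarrow> real ^ 'm) \<times> (int \<Rightarrow> real ^ 'm)). fst z k"
  let ?Y = "\<lambda>k (z :: (int \<Rightarrow> real ^ 'm) \<times> (int \<Rightarrow> real ^ 'm)). snd z k"
  have cpl: "is_coupling (distr Q P J) ?X ?Y p q"
    unfolding is_coupling_def process_def process_law_def pq
    using prob_space.prob_space_distr[OF pr J] c1 c2 f1 f2 J
    by (auto simp: distr_distr J_def comp_def)
  have "(\<integral>\<^sup>+ z. ennreal (\<Sum>k\<in>{0..int i}. (norm (?X k z - ?Y k z))\<^sup>2) \<partial>distr Q P J) =
        (\<integral>\<^sup>+ \<omega>. ennreal (\<Sum>k\<in>{0..int i}. (norm (X k \<omega> - Y k \<omega>))\<^sup>2) \<partial>Q)" for i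
    using c1[measurable] c2[measurable] by (subst nn_integral_distr[OF J]) (auto simp: J_def)
  then have "avg_cost (distr Q P J) ?X ?Y = avg_cost Q X Y"
    by (simp add: avg_cost_def)
  then have "(INF (Q, X, Y) \<in> {(Q :: ((int \<Rightarrow> real ^ 'm) \<times> (int \<Rightarrow> real ^ 'm)) measure, X, Y).
                        is_coupling Q X Y p q}. avg_cost Q X Y) \<le> avg_cost Q X Y"
    using cpl by (intro INF_lower2[of "(distr Q P J, ?X, ?Y)"]) auto
  then show ?thesis
    unfolding avg_W2_def by (rule sqrt_ennreal_mono)
qed

end

theory Submission
  imports Defs
begin

text \<open>The bound is proved for the average cost of every single coupling, by passing to the frequency domain
  at finite horizon and letting the horizon grow.

  For jointly defined processes \<open>X\<close> and \<open>Y\<close>, let \<open>U\<close> and \<open>V\<close> be the Fourier transforms at frequency \<open>w\<close>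
  of their restrictions to the times \<open>0, \<dots>, n\<close>. By Parseval (\<open>nn_integral_mean_periodogram\<close>), the mean cost
  up to time \<open>n\<close> is the average over \<open>w\<close> of the expected squared norm of \<open>U - V\<close>, divided by \<open>n + 1\<close>.
  The covariance matrix of \<open>U\<close>, divided by \<open>n + 1\<close>, is the Fejer mean of the series defining the power
  spectrum of \<open>X\<close>, and likewise for \<open>V\<close> and \<open>Y\<close>. These Fejer means converge at every frequency because the series does
  (\<open>tendsto_expectation_dft_quadratic_form\<close>). Thus the problem at each frequency is finite-dimensional:
  bound the squared distance of two random vectors by their covariances.

  There the bound is linearised. For positive definite \<open>S\<close>, the Young inequality
  \<open>2 Re \<langle>u, v\<rangle> \<le> \<langle>u, S u\<rangle> + \<langle>v, S\<^sup>-\<^sup>1 v\<rangle>\<close> bounds the squared distance of \<open>U\<close> and \<open>V\<close> from below by a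
  quadratic form in \<open>U\<close> plus one in \<open>V\<close>; for the right \<open>S\<close>, chosen once from the two limiting spectra, the value
  in the limit is the trace of \<open>W_mat\<close> (\<open>trace_W_mat_dual\<close>). Fatou's lemma then integrates the pointwise
  limit inferior over the frequencies (\<open>spectral_lower_bound_le_avg_cost\<close>).

  The matrix square root in \<open>W_mat\<close> is given by a definite description, so its existence and uniqueness on
  positive definite matrices have to be established; existence comes from a contraction
  argument (\<open>hermitian_pos_def_sqrt_exists\<close>).\<close>

section \<open>Hermitian matrices\<close>

definition conj_transpose :: "complex ^ 'n ^ 'm \<Rightarrow> complex ^ 'm ^ 'n" where
  "conj_transpose A = (\<chi> a b. cnj (A $ b $ a))"

lemma conj_transpose_mult: "conj_transpose (A ** B) = conj_transpose B ** conj_transpose A"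
  by (simp add: vec_eq_iff conj_transpose_def matrix_matrix_mult_def mult.commute)

lemma conj_transpose_mat_1 [simp]: "conj_transpose (mat 1) = mat 1"
  by (simp add: vec_eq_iff conj_transpose_def mat_def)

lemma conj_transpose_add: "conj_transpose (A + B) = conj_transpose A + conj_transpose B"
  and conj_transpose_diff: "conj_transpose (A - B) = conj_transpose A - conj_transpose B"
  and conj_transpose_scaleR: "conj_transpose (c *\<^sub>R A) = c *\<^sub>R conj_transpose A"
  by (simp_all add: vec_eq_iff conj_transpose_def)

lemma norm_matrix_sq:
  fixes A :: "complex ^ 'n ^ 'm"
  shows "(norm A)\<^sup>2 = (\<Sum>a\<in>UNIV. \<Sum>b\<in>UNIV. (norm (A $ a $ b))\<^sup>2)"
  by (simp add: norm_vec_def L2_set_def sum_nonneg)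

lemma norm_conj_transpose: "norm (conj_transpose A) = norm A"
proof -
  have "(norm (conj_transpose A))\<^sup>2 = (norm A)\<^sup>2"
    unfolding norm_matrix_sq by (subst sum.swap) (simp add: conj_transpose_def)
  then show ?thesis by simp
qed

lemma inner_complex_vec:
  fixes u v :: "complex ^ 'n"
  shows "u \<bullet> v = Re (\<Sum>a\<in>UNIV. cnj (u $ a) * v $ a)"
  by (simp add: inner_vec_def inner_complex_def)

lemma inner_conj_transpose:
  fixes u :: "complex ^ 'n"
  shows "(A *v u) \<bullet> v = u \<bullet> (conj_transpose A *v v)"
proof -
  have "(\<Sum>a\<in>UNIV. cnj ((A *v u) $ a) * v $ a) = (\<Sum>a\<in>UNIV. \<Sum>b\<in>UNIV. cnj (A $ a $ b) * cnj (u $ b) * v $ a)"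
    by (simp add: matrix_vector_mult_def sum_distrib_right)
  also have "\<dots> = (\<Sum>b\<in>UNIV. \<Sum>a\<in>UNIV. cnj (A $ a $ b) * cnj (u $ b) * v $ a)"
    by (rule sum.swap)
  also have "\<dots> = (\<Sum>b\<in>UNIV. cnj (u $ b) * (conj_transpose A *v v) $ b)"
    by (simp add: matrix_vector_mult_def conj_transpose_def sum_distrib_left mult_ac)
  finally show ?thesis by (simp only: inner_complex_vec)
qed

lemma hermitian_pos_def_iff:
  "hermitian_pos_def A \<longleftrightarrow> conj_transpose A = A \<and> (\<forall>v. v \<noteq> 0 \<longrightarrow> v \<bullet> (A *v v) > 0)"
proof -
  have "(\<forall>a b. A $ a $ b = cnj (A $ b $ a)) \<longleftrightarrow> conj_transpose A = A"
    by (simp add: conj_transpose_def vec_eq_iff) (rule iffI; rule allI; rule allI; rule sym; blast)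
  then show ?thesis
    unfolding hermitian_pos_def_def inner_complex_vec by (simp only:)
qed

lemma hermitian_pos_def_nonneg:
  "hermitian_pos_def A \<Longrightarrow> v \<bullet> (A *v v) \<ge> 0"
  by (cases "v = 0") (auto simp: hermitian_pos_def_iff less_imp_le)

lemma scaleR_matrix_vector: "(c *\<^sub>R A) *v v = c *\<^sub>R (A *v v)" for A :: "complex ^ 'n ^ 'm"
  by (simp add: vec_eq_iff matrix_vector_mult_def scaleR_sum_right)

lemma scaleR_matrix_mult_left: "(c *\<^sub>R A) ** B = c *\<^sub>R (A ** B)"
  and scaleR_matrix_mult_right: "A ** (c *\<^sub>R B) = c *\<^sub>R (A ** B)"
  for A :: "complex ^ 'n ^ 'm"
  by (simp_all add: vec_eq_iff matrix_matrix_mult_def scaleR_sum_right)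

lemma matrix_mult_diff_left: "(A - B) ** C = A ** C - B ** C"
  and matrix_mult_diff_right: "D ** (A - B) = D ** A - D ** B"
  for A B :: "complex ^ 'n ^ 'm"
  by (simp_all add: vec_eq_iff matrix_matrix_mult_def sum_subtractf algebra_simps)

section \<open>Square roots of positive definite matrices\<close>

text \<open>The ambient norm on matrices is the Frobenius norm. In a product it may be bounded using only the
  operator norm of one factor, since the product acts column by column. This mixed estimate keeps the
  contraction constant below one in the fixed point argument for square roots; the Frobenius norm
  alone would not, as the identity already has norm the square root of the dimension.\<close>

lemma norm_matrix_mult_le:
  fixes A :: "complex ^ 'n ^ 'm" and B :: "complex ^ 'k ^ 'n"
  assumes A: "\<And>v. norm (A *v v) \<le> q * norm v" and q: "0 \<le> q"
  shows "norm (A ** B) \<le> q * norm B"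
proof -
  let ?col = "\<lambda>c. \<chi> b. B $ b $ c"
  have col: "(\<Sum>a\<in>UNIV. (norm ((A ** B) $ a $ c))\<^sup>2) = (norm (A *v ?col c))\<^sup>2" for c
    by (simp add: norm_vec_def L2_set_def sum_nonneg matrix_matrix_mult_def matrix_vector_mult_def)
  have "(norm (A ** B))\<^sup>2 = (\<Sum>c\<in>UNIV. (norm (A *v ?col c))\<^sup>2)"
    unfolding norm_matrix_sq by (subst sum.swap) (simp add: col)
  also have "\<dots> \<le> (\<Sum>c\<in>UNIV. (q * norm (?col c))\<^sup>2)"
    by (intro sum_mono power_mono A) auto
  also have "\<dots> = q\<^sup>2 * (\<Sum>c\<in>UNIV. \<Sum>b\<in>UNIV. (norm (B $ b $ c))\<^sup>2)"
    by (simp add: norm_vec_def L2_set_def sum_nonneg power_mult_distrib sum_distrib_left)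
  also have "\<dots> = (q * norm B)\<^sup>2"
    unfolding norm_matrix_sq power_mult_distrib by (subst sum.swap) simp
  finally show ?thesis
    using q by (simp add: power_mono_iff)
qed

lemma continuous_on_quadratic_form: "continuous_on S (\<lambda>v. v \<bullet> (A *v v))"
  for A :: "complex ^ 'n ^ 'n"
  by (intro continuous_intros linear_continuous_on matrix_vector_mul_bounded_linear)

text \<open>For a unit vector \<open>v\<close>, the square of \<open>norm (v - t A v)\<close> is \<open>1 - 2 t \<langle>v, A v\<rangle> + t\<^sup>2 (norm (A v))\<^sup>2\<close>. By
  compactness of the sphere the linear term is bounded away from zero, so it beats the quadratic one
  for small \<open>t\<close>.\<close>

lemma hermitian_pos_def_contraction:
  fixes A :: "complex ^ 'n ^ 'n"
  assumes A: "hermitian_pos_def A"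
  obtains t r where "t > 0" "0 \<le> r" "r < 1" "\<And>v. norm ((mat 1 - t *\<^sub>R A) *v v) \<le> r * norm v"
proof -
  have bl: "bounded_linear ((*v) A)"
    by (rule matrix_vector_mul_bounded_linear)
  obtain L where L: "L > 0" "\<And>v. norm (A *v v) \<le> norm v * L"
    using bounded_linear.pos_bounded[OF bl] by auto
  have "\<exists>a>0. \<forall>v\<in>sphere 0 1. a \<le> v \<bullet> (A *v v)"
  proof -
    have "sphere 0 1 \<noteq> ({} :: (complex ^ 'n) set)" by simp
    then obtain u :: "complex ^ 'n" where u: "u \<in> sphere 0 1" "\<forall>v\<in>sphere 0 1. u \<bullet> (A *v u) \<le> v \<bullet> (A *v v)"
      using continuous_attains_inf[OF compact_sphere _ continuous_on_quadratic_form] by metis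
    then have "u \<noteq> 0" by auto
    then show ?thesis using A u by (auto simp: hermitian_pos_def_iff)
  qed
  then obtain a where a: "a > 0" "\<And>v. v \<in> sphere 0 1 \<Longrightarrow> a \<le> v \<bullet> (A *v v)" by auto
  have low: "a * (norm v)\<^sup>2 \<le> v \<bullet> (A *v v)" for v
  proof (cases "v = 0")
    case False
    have "a \<le> ((1 / norm v) *\<^sub>R v) \<bullet> (A *v ((1 / norm v) *\<^sub>R v))"
      by (rule a) (use False in auto)
    also have "\<dots> = (v \<bullet> (A *v v)) / (norm v)\<^sup>2"
      by (simp add: linear_scale[OF bounded_linear.linear[OF bl]] power2_eq_square)
    finally show ?thesis using False by (simp add: field_simps)
  qed simp
  \<comment> \<open>This \<open>t\<close> minimises the bound \<open>1 - 2 t a + t\<^sup>2 L\<^sup>2\<close>.\<close>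
  define t where "t = a / L\<^sup>2"
  define r where "r = sqrt (max 0 (1 - a\<^sup>2 / L\<^sup>2))"
  have t: "t > 0" using a L by (simp add: t_def)
  have r: "0 \<le> r" "r < 1" using a L by (auto simp: r_def)
  have "norm ((mat 1 - t *\<^sub>R A) *v v) \<le> r * norm v" for v
  proof -
    have "(norm ((mat 1 - t *\<^sub>R A) *v v))\<^sup>2 = (norm v)\<^sup>2 - 2 * t * (v \<bullet> (A *v v)) + t\<^sup>2 * (norm (A *v v))\<^sup>2"
      unfolding matrix_vector_mult_diff_rdistrib scaleR_matrix_vector matrix_vector_mul_lid power2_norm_eq_inner
      by (simp add: inner_diff_left inner_diff_right inner_commute power2_eq_square algebra_simps del: dot_square_norm)
    also have "\<dots> \<le> (norm v)\<^sup>2 - 2 * t * (a * (norm v)\<^sup>2) + t\<^sup>2 * (norm v * L)\<^sup>2"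
      using low[of v] L(2)[of v] t by (intro add_mono diff_mono mult_left_mono power_mono) auto
    also have "\<dots> = (1 - a\<^sup>2 / L\<^sup>2) * (norm v)\<^sup>2"
      using L by (simp add: t_def field_simps power2_eq_square)
    also have "\<dots> \<le> r\<^sup>2 * (norm v)\<^sup>2"
      by (intro mult_right_mono) (auto simp: r_def)
    finally have "(norm ((mat 1 - t *\<^sub>R A) *v v))\<^sup>2 \<le> (r * norm v)\<^sup>2"
      by (simp add: power_mult_distrib)
    then show ?thesis
      by (rule power2_le_imp_le) (use r in simp)
  qed
  with t r show ?thesis by (rule that)
qed

text \<open>Rescale \<open>A\<close> to \<open>1 - E\<close> with \<open>E\<close> of operator norm at most \<open>r < 1\<close>, and look for a root of the form
  \<open>1 - Y\<close>. The equation \<open>(1 - Y)\<^sup>2 = 1 - E\<close> reads \<open>Y = (E + Y\<^sup>2) / 2\<close>, and the right-hand side is a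
  contraction of the set of Hermitian \<open>Y\<close> with operator norm at most \<open>q\<close>.\<close>

lemma hermitian_pos_def_sqrt_exists:
  fixes A :: "complex ^ 'n ^ 'n"
  assumes A: "hermitian_pos_def A"
  shows "\<exists>B. hermitian_pos_def B \<and> B ** B = A"
proof -
  obtain t r where t: "t > 0" and r: "0 \<le> r" "r < 1"
    and contr: "\<And>v. norm ((mat 1 - t *\<^sub>R A) *v v) \<le> r * norm v"
    using hermitian_pos_def_contraction[OF A] by blast
  define E where "E = mat 1 - t *\<^sub>R A"
  \<comment> \<open>The scalar solution of \<open>q = (r + q\<^sup>2) / 2\<close> below one: the radius of a ball that the iteration preserves.\<close>
  define q where "q = 1 - sqrt (1 - r)"
  have q: "0 \<le> q" "q < 1" "(r + q * q) / 2 = q"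
    using r by (auto simp: q_def algebra_simps add_divide_distrib diff_divide_distrib)
  define K where "K = {Y :: complex ^ 'n ^ 'n. conj_transpose Y = Y \<and> (\<forall>v. norm (Y *v v) \<le> q * norm v)}"
  define T where "T Y = (1/2) *\<^sub>R (E + Y ** Y)" for Y
  have E: "conj_transpose E = E"
    using A by (simp add: E_def conj_transpose_diff conj_transpose_scaleR hermitian_pos_def_iff)
  have "closed K"
  proof -
    have "K = (\<Inter>a b. {Y. cnj (Y $ b $ a) = Y $ a $ b}) \<inter> (\<Inter>v. {Y. norm (Y *v v) \<le> q * norm v})"
      by (auto simp: K_def conj_transpose_def vec_eq_iff)
    moreover have "closed {Y :: complex ^ 'n ^ 'n. cnj (Y $ b $ a) = Y $ a $ b}" for a b
      by (intro closed_Collect_eq continuous_intros)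
    moreover have cont: "continuous_on UNIV (\<lambda>Y :: complex ^ 'n ^ 'n. norm (Y *v v))" for v
      unfolding matrix_vector_mult_def by (intro continuous_intros)
    have "closed {Y :: complex ^ 'n ^ 'n. norm (Y *v v) \<le> q * norm v}" for v
      by (intro closed_Collect_le cont continuous_on_const)
    ultimately show ?thesis by (auto intro!: closed_Int closed_INT)
  qed
  then have "Topological_Spaces.complete K" by (simp add: complete_eq_closed)
  moreover have "0 \<in> K" using q by (auto simp: K_def conj_transpose_def vec_eq_iff)
  moreover have "T ` K \<subseteq> K"
  proof clarify
    fix Y assume Y: "Y \<in> K"
    have "norm (T Y *v v) \<le> q * norm v" for v
    proof -
      have "norm (T Y *v v) = norm (E *v v + Y *v (Y *v v)) / 2"
        by (simp add: T_def scaleR_matrix_vector matrix_vector_mult_add_rdistrib matrix_vector_mul_assoc)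
      also have "norm (E *v v + Y *v (Y *v v)) \<le> norm (E *v v) + norm (Y *v (Y *v v))"
        by (rule norm_triangle_ineq)
      also have "norm (E *v v) \<le> r * norm v" by (simp add: E_def contr)
      also have "norm (Y *v (Y *v v)) \<le> q * norm (Y *v v)" using Y by (simp add: K_def)
      also have "norm (Y *v v) \<le> q * norm v" using Y by (simp add: K_def)
      finally have "norm (T Y *v v) \<le> (r * norm v + q * (q * norm v)) / 2"
        using q by (simp add: mult_left_mono)
      also have "\<dots> = (r + q * q) / 2 * norm v" by (simp add: algebra_simps)
      finally show ?thesis using q by simp
    qed
    moreover have "conj_transpose (T Y) = T Y"
      using Y E by (simp add: T_def K_def conj_transpose_scaleR conj_transpose_add conj_transpose_mult)
    ultimately show "T Y \<in> K" by (simp add: K_def)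
  qed
  moreover have "dist (T Y) (T Z) \<le> q * dist Y Z" if Y: "Y \<in> K" and Z: "Z \<in> K" for Y Z
  proof -
    \<comment> \<open>Taking adjoints moves the factor with small operator norm to the left.\<close>
    have "norm ((Y - Z) ** Z) = norm (Z ** (Y - Z))"
      using Y Z norm_conj_transpose[of "(Y - Z) ** Z"]
      by (simp add: conj_transpose_mult conj_transpose_diff K_def)
    moreover have "norm (Z ** (Y - Z)) \<le> q * norm (Y - Z)" "norm (Y ** (Y - Z)) \<le> q * norm (Y - Z)"
      using Y Z q by (auto intro!: norm_matrix_mult_le simp: K_def)
    moreover have "T Y - T Z = (1/2) *\<^sub>R (Y ** (Y - Z) + (Y - Z) ** Z)"
      by (simp add: T_def matrix_mult_diff_left matrix_mult_diff_right algebra_simps)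
    moreover have "norm (Y ** (Y - Z) + (Y - Z) ** Z) \<le> norm (Y ** (Y - Z)) + norm ((Y - Z) ** Z)"
      by (rule norm_triangle_ineq)
    ultimately show ?thesis by (simp add: dist_norm)
  qed
  ultimately have "\<exists>!Y. Y \<in> K \<and> T Y = Y"
    using q by (intro Banach_fix[of K q T]) auto
  then obtain Y where Y: "Y \<in> K" "T Y = Y" by blast
  define B where "B = (1 / sqrt t) *\<^sub>R (mat 1 - Y)"
  have "E + Y ** Y = 2 *\<^sub>R Y"
    using arg_cong[OF Y(2), of "\<lambda>Z. 2 *\<^sub>R Z"] by (simp add: T_def)
  then have "(mat 1 - Y) ** (mat 1 - Y) = t *\<^sub>R A"
    unfolding matrix_mult_diff_left matrix_mult_diff_right
    by (simp add: E_def algebra_simps scaleR_2)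
  then have "B ** B = A"
    using t by (simp add: B_def scaleR_matrix_mult_left scaleR_matrix_mult_right)
  moreover have "hermitian_pos_def B"
  proof -
    have "v \<bullet> (B *v v) > 0" if "v \<noteq> 0" for v
    proof -
      have "v \<bullet> (Y *v v) \<le> norm v * norm (Y *v v)" by (rule norm_cauchy_schwarz)
      also have "\<dots> \<le> norm v * (q * norm v)" using Y by (intro mult_left_mono) (auto simp: K_def)
      also have "\<dots> < norm v * (1 * norm v)" using q that by simp
      also have "\<dots> = v \<bullet> v" by (simp add: dot_square_norm power2_eq_square)
      finally show ?thesis
        using t by (simp add: B_def scaleR_matrix_vector matrix_vector_mult_diff_rdistrib inner_diff_right)
    qed
    moreover have "conj_transpose B = B"
      using Y by (simp add: B_def conj_transpose_scaleR conj_transpose_diff K_def)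
    ultimately show ?thesis by (simp add: hermitian_pos_def_iff)
  qed
  ultimately show ?thesis by blast
qed

lemma Re_trace_sandwich:
  fixes B D :: "complex ^ 'n ^ 'n"
  assumes "conj_transpose D = D"
  shows "Re (trace (D ** B ** D)) = (\<Sum>c\<in>UNIV. (\<chi> a. D $ a $ c) \<bullet> (B *v (\<chi> a. D $ a $ c)))"
proof -
  have D: "cnj (D $ a $ c) = D $ c $ a" for a c
    using assms by (simp add: conj_transpose_def vec_eq_iff)
  have "trace (D ** B ** D) = (\<Sum>c\<in>UNIV. \<Sum>b\<in>UNIV. \<Sum>a\<in>UNIV. D $ c $ a * B $ a $ b * D $ b $ c)"
    by (simp add: trace_def matrix_matrix_mult_def sum_distrib_right)
  also have "\<dots> = (\<Sum>c\<in>UNIV. \<Sum>a\<in>UNIV. \<Sum>b\<in>UNIV. D $ c $ a * B $ a $ b * D $ b $ c)"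
    by (intro sum.cong refl sum.swap)
  also have "\<dots> = (\<Sum>c\<in>UNIV. \<Sum>a\<in>UNIV. cnj ((\<chi> a. D $ a $ c) $ a) * (B *v (\<chi> a. D $ a $ c)) $ a)"
    by (simp add: matrix_vector_mult_def D sum_distrib_left mult_ac)
  finally show ?thesis by (simp add: inner_complex_vec)
qed

text \<open>For \<open>D = B - C\<close>, equality of the squares gives \<open>B D + D C = 0\<close>. Multiplying by \<open>D\<close> and taking traces
  yields \<open>tr (D B D) + tr (D C D) = 0\<close>, a sum of two nonnegative terms, and \<open>tr (D B D)\<close> vanishes only
  if every column of \<open>D\<close> does.\<close>

lemma hermitian_pos_def_sqrt_unique:
  fixes B C :: "complex ^ 'n ^ 'n"
  assumes B: "hermitian_pos_def B" and C: "hermitian_pos_def C" and eq: "B ** B = C ** C"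
  shows "B = C"
proof -
  define D where "D = B - C"
  have D: "conj_transpose D = D"
    using B C by (simp add: D_def conj_transpose_diff hermitian_pos_def_iff)
  let ?col = "\<lambda>c. \<chi> a. D $ a $ c"
  have "B ** D + D ** C = 0"
    using eq by (simp add: D_def matrix_mult_diff_left matrix_mult_diff_right)
  then have "trace (D ** (B ** D + D ** C)) = 0"
    by (simp add: trace_def matrix_matrix_mult_def)
  then have "trace (D ** B ** D) + trace (D ** (D ** C)) = 0"
    by (simp add: matrix_add_ldistrib trace_add matrix_mul_assoc)
  moreover have "trace (D ** (D ** C)) = trace (D ** C ** D)"
    by (metis trace_mul_sym)
  ultimately have "Re (trace (D ** B ** D)) + Re (trace (D ** C ** D)) = 0"
    by (metis plus_complex.simps(1) zero_complex.simps(1))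
  moreover have nn: "?col c \<bullet> (B *v ?col c) \<ge> 0" "?col c \<bullet> (C *v ?col c) \<ge> 0" for c
    using B C by (auto intro: hermitian_pos_def_nonneg)
  ultimately have "(\<Sum>c\<in>UNIV. ?col c \<bullet> (B *v ?col c)) = 0"
    using D sum_nonneg[of UNIV "\<lambda>c. ?col c \<bullet> (B *v ?col c)"] sum_nonneg[of UNIV "\<lambda>c. ?col c \<bullet> (C *v ?col c)"]
    by (simp add: Re_trace_sandwich)
  then have "?col c \<bullet> (B *v ?col c) = 0" for c
    using nn by (simp add: sum_nonneg_eq_0_iff)
  then have "?col c = 0" for c
    using B unfolding hermitian_pos_def_iff by (metis less_irrefl)
  then have "D = 0" by (simp add: vec_eq_iff)
  then show ?thesis by (simp add: D_def)
qed

lemma matrix_sqrt: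
  assumes "hermitian_pos_def A"
  shows "hermitian_pos_def (matrix_sqrt A)" "matrix_sqrt A ** matrix_sqrt A = A"
proof -
  have "\<exists>!B. hermitian_pos_def B \<and> B ** B = A"
    using hermitian_pos_def_sqrt_exists[OF assms] hermitian_pos_def_sqrt_unique by metis
  then have "hermitian_pos_def (matrix_sqrt A) \<and> matrix_sqrt A ** matrix_sqrt A = A"
    unfolding matrix_sqrt_def by (rule theI')
  then show "hermitian_pos_def (matrix_sqrt A)" "matrix_sqrt A ** matrix_sqrt A = A" by auto
qed

section \<open>A dual formula for the spectral transport cost\<close>

lemma hermitian_pos_def_inverse:
  fixes A :: "complex ^ 'n ^ 'n"
  assumes A: "hermitian_pos_def A"
  obtains B where "A ** B = mat 1" "B ** A = mat 1" "conj_transpose B = B"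
proof -
  have "\<forall>v. A *v v = 0 \<longrightarrow> v = 0"
    using A unfolding hermitian_pos_def_iff by (metis inner_zero_right less_irrefl)
  then obtain B where B: "B ** A = mat 1" using matrix_left_invertible_ker by blast
  then have B': "A ** B = mat 1" by (simp add: matrix_left_right_inverse)
  have "conj_transpose B ** A = mat 1"
    using arg_cong[OF B', of conj_transpose] A by (simp add: conj_transpose_mult hermitian_pos_def_iff)
  then have "conj_transpose B = B"
    by (metis B' matrix_mul_assoc matrix_mul_lid matrix_mul_rid)
  with B B' show ?thesis by (intro that) auto
qed

lemma hermitian_pos_def_congruence:
  fixes A R :: "complex ^ 'n ^ 'n"
  assumes A: "hermitian_pos_def A" and R: "conj_transpose R = R" and inj: "\<And>v. R *v v = 0 \<Longrightarrow> v = 0"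
  shows "hermitian_pos_def (R ** A ** R)"
proof -
  have "v \<bullet> ((R ** A ** R) *v v) = (R *v v) \<bullet> (A *v (R *v v))" for v
    using R by (simp add: inner_conj_transpose matrix_vector_mul_assoc matrix_mul_assoc)
  moreover have "conj_transpose (R ** A ** R) = R ** A ** R"
    using A R by (simp add: conj_transpose_mult hermitian_pos_def_iff matrix_mul_assoc)
  ultimately show ?thesis
    using A inj by (auto simp: hermitian_pos_def_iff)
qed

text \<open>A Young inequality with matrix weight: with \<open>T\<close> the inverse of \<open>S\<close>, the difference of the two sides
  is the value of the form of \<open>S\<close> at \<open>u - T v\<close>.\<close>

lemma inner_le_quadratic_forms:
  fixes S T :: "complex ^ 'n ^ 'n"
  assumes S: "hermitian_pos_def S" and T: "S ** T = mat 1" "conj_transpose T = T"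
  shows "2 * (u \<bullet> v) \<le> u \<bullet> (S *v u) + v \<bullet> (T *v v)"
proof -
  define z where "z = u - T *v v"
  have Sz: "S *v z = S *v u - v"
    by (simp add: z_def matrix_vector_mult_diff_distrib matrix_vector_mul_assoc T)
  have "0 \<le> z \<bullet> (S *v z)" using S by (rule hermitian_pos_def_nonneg)
  also have "\<dots> = u \<bullet> (S *v u) - u \<bullet> v - (T *v v) \<bullet> (S *v u) + (T *v v) \<bullet> v"
    unfolding Sz by (simp add: z_def inner_diff_left inner_diff_right)
  also have "(T *v v) \<bullet> (S *v u) = v \<bullet> u"
  proof -
    have "T ** S = mat 1" using T(1) by (simp add: matrix_left_right_inverse)
    then show ?thesis by (simp add: inner_conj_transpose T(2) matrix_vector_mul_assoc)
  qed
  also have "(T *v v) \<bullet> v = v \<bullet> (T *v v)" by (rule inner_commute)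
  finally show ?thesis by (simp add: inner_commute)
qed

text \<open>Duality for the finite-dimensional transport cost: the trace of \<open>W_mat A B\<close> is attained by a pair of
  quadratic forms whose sum is a pointwise lower bound of the quadratic cost. With \<open>R\<close> the root of \<open>A\<close>
  and \<open>C\<close> the root of \<open>R B R\<close>, the weight \<open>S = R\<^sup>-\<^sup>1 C R\<^sup>-\<^sup>1\<close> is the optimal transport map between Gaussian laws
  with covariances \<open>A\<close> and \<open>B\<close>; the Young inequality for \<open>S\<close> gives the lower bound, and
  \<open>tr (S A) = tr (S\<^sup>-\<^sup>1 B) = tr C\<close> gives the value.

  For fixed forms the value is linear in the two covariances, which is what lets the bound pass to
  limits of covariance matrices.\<close>

lemma trace_W_mat_dual:
  fixes A B :: "complex ^ 'n ^ 'n"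
  assumes A: "hermitian_pos_def A" and B: "hermitian_pos_def B"
  obtains G H where
    "\<And>u v. u \<bullet> (G *v u) + v \<bullet> (H *v v) \<le> (norm (u - v))\<^sup>2"
    "trace (W_mat A B) = trace (G ** A) + trace (H ** B)"
proof -
  define R where "R = matrix_sqrt A"
  have R: "hermitian_pos_def R" "R ** R = A" using matrix_sqrt[OF A] by (auto simp: R_def)
  obtain Ri where Ri: "R ** Ri = mat 1" "Ri ** R = mat 1" "conj_transpose Ri = Ri"
    using hermitian_pos_def_inverse[OF R(1)] .
  have R': "conj_transpose R = R" using R by (simp add: hermitian_pos_def_iff)
  have Rinj: "v = 0" if "R *v v = 0" for v
    using that Ri(2) by (metis matrix_vector_mul_assoc matrix_vector_mul_lid matrix_vector_mult_0_right)
  have Riinj: "v = 0" if "Ri *v v = 0" for v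
    using that Ri(1) by (metis matrix_vector_mul_assoc matrix_vector_mul_lid matrix_vector_mult_0_right)
  define C where "C = matrix_sqrt (R ** B ** R)"
  have C: "hermitian_pos_def C" "C ** C = R ** B ** R"
    using matrix_sqrt[OF hermitian_pos_def_congruence[OF B R' Rinj]] by (auto simp: C_def)
  obtain Ci where Ci: "C ** Ci = mat 1" "Ci ** C = mat 1" "conj_transpose Ci = Ci"
    using hermitian_pos_def_inverse[OF C(1)] .
  define S where "S = Ri ** C ** Ri"
  define T where "T = R ** Ci ** R"
  have S: "hermitian_pos_def S"
    unfolding S_def by (rule hermitian_pos_def_congruence[OF C(1) Ri(3) Riinj])
  have "S ** T = Ri ** (C ** (Ri ** R) ** Ci) ** R"
    by (simp add: S_def T_def matrix_mul_assoc)
  then have ST: "S ** T = mat 1" by (simp add: Ri Ci)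
  have T: "conj_transpose T = T"
    by (simp add: T_def conj_transpose_mult R' Ci matrix_mul_assoc)
  have "u \<bullet> ((mat 1 - S) *v u) + v \<bullet> ((mat 1 - T) *v v) \<le> (norm (u - v))\<^sup>2" for u v
    using inner_le_quadratic_forms[OF S ST T, of u v]
    by (simp add: matrix_vector_mult_diff_rdistrib inner_diff_left inner_diff_right
        power2_norm_eq_inner inner_commute)
  moreover have "trace (W_mat A B) = trace ((mat 1 - S) ** A) + trace ((mat 1 - T) ** B)"
  proof -
    have "S ** A = Ri ** (C ** (Ri ** R) ** R)"
      by (simp add: S_def R(2)[symmetric] matrix_mul_assoc)
    then have "trace (S ** A) = trace ((C ** R) ** Ri)"
      by (simp add: Ri trace_mul_sym[of Ri])
    also have "\<dots> = trace C" by (simp add: matrix_mul_assoc[symmetric] Ri)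
    finally have 1: "trace (S ** A) = trace C" .
    have "trace (T ** B) = trace (R ** (Ci ** R ** B))"
      by (simp add: T_def matrix_mul_assoc)
    also have "\<dots> = trace (Ci ** (R ** B ** R))"
      by (subst trace_mul_sym) (simp add: matrix_mul_assoc)
    also have "\<dots> = trace ((Ci ** C) ** C)"
      by (simp add: C(2)[symmetric] matrix_mul_assoc)
    finally have 2: "trace (T ** B) = trace C" by (simp add: Ci)
    have "trace (2 *\<^sub>R C) = 2 * trace C"
      by (simp add: trace_def sum_distrib_left scaleR_conv_of_real)
    then show ?thesis
      using 1 2 by (simp add: W_mat_def R_def[symmetric] C_def[symmetric] trace_add trace_sub
          matrix_mult_diff_left)
  qed
  ultimately show ?thesis by (rule that)
qed

section \<open>Fejer means\<close>

lemma sum_int_atMost_Suc: "(\<Sum>k\<in>{0..int (Suc n)}. f k) = (\<Sum>k\<in>{0..int n}. f k) + f (int n + 1)"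
proof -
  have "{0..int (Suc n)} = insert (int n + 1) {0..int n}" by auto
  then show ?thesis by (simp add: add.commute)
qed

text \<open>The reason why Fejer means appear: summing a function of the lag over a square of times gives the
  sum of its symmetric partial sums. Enlarging the square by one adds each lag from \<open>- n - 1\<close> to
  \<open>n + 1\<close> exactly once.\<close>

lemma sum_lags_eq_sum_partial_sums:
  fixes c :: "int \<Rightarrow> 'a :: ab_group_add"
  shows "(\<Sum>k\<in>{0..int n}. \<Sum>l\<in>{0..int n}. c (l - k)) = (\<Sum>N\<le>n. \<Sum>j\<in>{- int N..int N}. c j)"
proof (induction n)
  case (Suc n)
  have pos: "(\<Sum>k\<in>{0..int n}. c (int n + 1 - k)) = (\<Sum>j\<in>{1..int n + 1}. c j)"
    by (rule sum.reindex_bij_witness[of _ "\<lambda>j. int n + 1 - j" "\<lambda>k. int n + 1 - k"]) auto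
  have neg: "(\<Sum>l\<in>{0..int n}. c (l - (int n + 1))) = (\<Sum>j\<in>{- int n - 1..-1}. c j)"
    by (rule sum.reindex_bij_witness[of _ "\<lambda>j. j + (int n + 1)" "\<lambda>l. l - (int n + 1)"]) auto
  have split: "{- int (Suc n)..int (Suc n)} = insert 0 ({1..int n + 1} \<union> {- int n - 1..-1})"
    by auto
  have "(\<Sum>j\<in>{- int (Suc n)..int (Suc n)}. c j) = c 0 + ((\<Sum>j\<in>{1..int n + 1}. c j) + (\<Sum>j\<in>{- int n - 1..-1}. c j))"
    unfolding split by (subst sum.insert) (auto simp: sum.union_disjoint)
  then show ?case
    using Suc by (simp add: sum_int_atMost_Suc sum.distrib pos neg del: of_nat_Suc)
qed simp

lemma tendsto_cesaro_mean:
  fixes f :: "nat \<Rightarrow> 'a :: real_normed_vector"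
  assumes "f \<longlonglongrightarrow> L"
  shows "(\<lambda>n. (1 / real (n + 1)) *\<^sub>R (\<Sum>N\<le>n. f N)) \<longlonglongrightarrow> L"
proof (rule LIMSEQ_I)
  fix e :: real assume e: "0 < e"
  obtain N0 where N0: "\<And>N. N \<ge> N0 \<Longrightarrow> norm (f N - L) < e / 2"
    using LIMSEQ_D[OF assms, of "e / 2"] e by auto
  define C where "C = (\<Sum>N<N0. norm (f N - L))"
  have C: "0 \<le> C" by (simp add: C_def sum_nonneg)
  obtain n1 :: nat where n1: "2 * C / e < n1" using reals_Archimedean2 by blast
  have "norm ((1 / real (n + 1)) *\<^sub>R (\<Sum>N\<le>n. f N) - L) < e" if n: "n \<ge> max N0 n1" for n
  proof -
    have "(1 / real (n + 1)) *\<^sub>R (\<Sum>N\<le>n. f N) - L = (1 / real (n + 1)) *\<^sub>R (\<Sum>N\<le>n. f N - L)"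
      by (simp add: sum_subtractf scaleR_diff_right sum_constant_scaleR)
    then have eq: "norm ((1 / real (n + 1)) *\<^sub>R (\<Sum>N\<le>n. f N) - L) = norm (\<Sum>N\<le>n. f N - L) / real (n + 1)"
      by simp
    have "norm (\<Sum>N\<le>n. f N - L) \<le> (\<Sum>N\<le>n. norm (f N - L))" by (rule norm_sum)
    also have "\<dots> \<le> (\<Sum>N\<le>n. (if N < N0 then norm (f N - L) else 0) + e / 2)"
      using N0 e by (intro sum_mono) (auto simp: not_less less_imp_le)
    also have "\<dots> = C + real (n + 1) * (e / 2)"
    proof -
      have "{..n} \<inter> {N. N < N0} = {..<N0}" using n by auto
      then show ?thesis by (simp add: sum.distrib C_def sum.If_cases)
    qed
    also have "\<dots> < real (n + 1) * e"
    proof -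
      have "2 * C < e * real n1" using n1 e by (simp add: field_simps)
      also have "\<dots> \<le> e * real (n + 1)" using n e by simp
      finally show ?thesis by (simp add: field_simps)
    qed
    finally show ?thesis unfolding eq by (simp add: divide_less_eq mult.commute)
  qed
  then show "\<exists>n0. \<forall>n\<ge>n0. norm ((1 / real (n + 1)) *\<^sub>R (\<Sum>N\<le>n. f N) - L) < e" by blast
qed

section \<open>Finite Fourier transforms of vector sequences\<close>

lemma sum_swap_pairs:
  "(\<Sum>a\<in>A. \<Sum>b\<in>B. \<Sum>k\<in>K. \<Sum>l\<in>L. f a b k l) = (\<Sum>k\<in>K. \<Sum>l\<in>L. \<Sum>a\<in>A. \<Sum>b\<in>B. f a b k l)"
  by (subst (2) sum.swap, subst sum.swap, subst (3) sum.swap, subst (2) sum.swap) (rule refl)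

text \<open>The sign of the exponent is the one for which the covariance of the transform at \<open>w\<close> approximates
  the power spectrum at \<open>w\<close>, rather than its transpose.\<close>

definition dft :: "nat \<Rightarrow> real \<Rightarrow> (int \<Rightarrow> real ^ 'm) \<Rightarrow> complex ^ 'm" where
  "dft n w d = (\<Sum>k\<in>{0..int n}. \<chi> a. cis (w * of_int k) * complex_of_real (d k $ a))"

lemma dft_diff: "dft n w d - dft n w d' = dft n w (\<lambda>k. d k - d' k)"
  unfolding dft_def sum_subtractf[symmetric]
  by (intro sum.cong refl) (simp add: vec_eq_iff algebra_simps)

lemma dft_nth: "dft n w d $ a = (\<Sum>k\<in>{0..int n}. cis (w * of_int k) * complex_of_real (d k $ a))"
  by (simp add: dft_def)

lemma dft_quadratic_form:
  fixes d :: "int \<Rightarrow> real ^ 'm"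
  shows "dft n w d \<bullet> (G *v dft n w d) =
    (\<Sum>k\<in>{0..int n}. \<Sum>l\<in>{0..int n}. \<Sum>a\<in>UNIV. \<Sum>b\<in>UNIV.
       Re (G $ b $ a * cis (w * of_int (k - l))) * (d k $ a * d l $ b))"
proof -
  have cis: "cnj (cis (w * of_int l)) * cis (w * of_int k) = cis (w * of_int (k - l))" for k l
    by (simp add: cis_cnj cis_mult algebra_simps)
  have "dft n w d \<bullet> (G *v dft n w d) =
      Re (\<Sum>b\<in>UNIV. \<Sum>a\<in>UNIV. cnj (dft n w d $ b) * (G $ b $ a * dft n w d $ a))"
    by (simp add: inner_complex_vec matrix_vector_mult_def sum_distrib_left)
  also have "(\<Sum>b\<in>UNIV. \<Sum>a\<in>UNIV. cnj (dft n w d $ b) * (G $ b $ a * dft n w d $ a)) =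
      (\<Sum>b\<in>UNIV. \<Sum>a\<in>UNIV. \<Sum>l\<in>{0..int n}. \<Sum>k\<in>{0..int n}.
         G $ b $ a * (cnj (cis (w * of_int l)) * cis (w * of_int k)) * complex_of_real (d k $ a * d l $ b))"
  proof (intro sum.cong refl)
    fix a b :: 'm
    have "cnj (dft n w d $ b) * (G $ b $ a * dft n w d $ a) = G $ b $ a * (cnj (dft n w d $ b) * dft n w d $ a)"
      by simp
    also have "\<dots> = (\<Sum>l\<in>{0..int n}. \<Sum>k\<in>{0..int n}.
         G $ b $ a * (cnj (cis (w * of_int l)) * cis (w * of_int k)) * complex_of_real (d k $ a * d l $ b))"
      unfolding dft_nth cnj_sum sum_product sum_distrib_left[where r = "G $ b $ a"]
      by (intro sum.cong refl) (simp add: mult_ac)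
    finally show "cnj (dft n w d $ b) * (G $ b $ a * dft n w d $ a) = (\<Sum>l\<in>{0..int n}. \<Sum>k\<in>{0..int n}.
         G $ b $ a * (cnj (cis (w * of_int l)) * cis (w * of_int k)) * complex_of_real (d k $ a * d l $ b))" .
  qed
  also have "\<dots> = (\<Sum>b\<in>UNIV. \<Sum>a\<in>UNIV. \<Sum>l\<in>{0..int n}. \<Sum>k\<in>{0..int n}.
         G $ b $ a * cis (w * of_int (k - l)) * complex_of_real (d k $ a * d l $ b))"
    unfolding cis ..
  also have "\<dots> = (\<Sum>a\<in>UNIV. \<Sum>b\<in>UNIV. \<Sum>k\<in>{0..int n}. \<Sum>l\<in>{0..int n}.
         G $ b $ a * cis (w * of_int (k - l)) * complex_of_real (d k $ a * d l $ b))"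
    by (subst sum.swap) (intro sum.cong refl sum.swap)
  also have "\<dots> = (\<Sum>k\<in>{0..int n}. \<Sum>l\<in>{0..int n}. \<Sum>a\<in>UNIV. \<Sum>b\<in>UNIV.
         G $ b $ a * cis (w * of_int (k - l)) * complex_of_real (d k $ a * d l $ b))"
    by (rule sum_swap_pairs)
  also have "Re \<dots> = (\<Sum>k\<in>{0..int n}. \<Sum>l\<in>{0..int n}. \<Sum>a\<in>UNIV. \<Sum>b\<in>UNIV.
       Re (G $ b $ a * cis (w * of_int (k - l))) * (d k $ a * d l $ b))"
    by (simp only: Re_sum Re_complex_of_real mult.assoc times_complex.sel Im_complex_of_real)
       (simp add: algebra_simps)
  finally show ?thesis .
qed

lemma norm_dft_sq:
  fixes d :: "int \<Rightarrow> real ^ 'm"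
  shows "(norm (dft n w d))\<^sup>2 = (\<Sum>k\<in>{0..int n}. \<Sum>l\<in>{0..int n}. cos (w * of_int (k - l)) * (d k \<bullet> d l))"
proof -
  have "(norm (dft n w d))\<^sup>2 = dft n w d \<bullet> (mat 1 *v dft n w d)"
    by (simp add: dot_square_norm)
  also have "\<dots> = (\<Sum>k\<in>{0..int n}. \<Sum>l\<in>{0..int n}. \<Sum>a\<in>UNIV. cos (w * of_int (k - l)) * (d k $ a * d l $ a))"
    unfolding dft_quadratic_form
  proof (intro sum.cong refl)
    fix k l and a :: 'm
    have "(\<Sum>b\<in>UNIV. Re (mat 1 $ b $ a * cis (w * of_int (k - l))) * (d k $ a * d l $ b)) =
        (\<Sum>b\<in>UNIV. if b = a then cos (w * of_int (k - l)) * (d k $ a * d l $ b) else 0)"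
      by (intro sum.cong refl) (simp add: mat_def)
    then show "(\<Sum>b\<in>UNIV. Re (mat 1 $ b $ a * cis (w * of_int (k - l))) * (d k $ a * d l $ b)) =
        cos (w * of_int (k - l)) * (d k $ a * d l $ a)"
      by simp
  qed
  finally show ?thesis by (simp add: inner_vec_def sum_distrib_left)
qed

lemma integral_cos_int:
  assumes "j \<noteq> 0"
  shows "((\<lambda>w. cos (w * of_int j)) has_integral 0) {0..2 * pi}"
proof -
  have "((\<lambda>w. cos (w * of_int j)) has_integral
      (sin (2 * pi * of_int j) / of_int j - sin (0 * of_int j) / of_int j)) {0..2 * pi}"
  proof (rule fundamental_theorem_of_calculus)
    fix w :: real
    show "((\<lambda>w. sin (w * of_int j) / of_int j) has_vector_derivative cos (w * of_int j)) (at w within {0..2 * pi})"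
      unfolding has_real_derivative_iff_has_vector_derivative[symmetric]
      using assms by (auto intro!: derivative_eq_intros)
  qed simp
  moreover have "sin (2 * pi * of_int j) = 0"
    by (simp add: sin_integer_2pi)
  ultimately show ?thesis by simp
qed

lemma has_integral_trig_form:
  "((\<lambda>w. \<Sum>k\<in>{0..int n}. \<Sum>l\<in>{0..int n}. cos (w * of_int (k - l)) * e k l) has_integral
     2 * pi * (\<Sum>k\<in>{0..int n}. e k k)) {0..2 * pi}"
proof -
  have "((\<lambda>w. cos (w * of_int (k - l)) * e k l) has_integral (if l = k then 2 * pi * e k l else 0)) {0..2 * pi}" for k l
  proof (cases "l = k")
    case True
    then show ?thesis using has_integral_const_real[of "e k l" 0 "2 * pi"] by simp
  next
    case False
    then show ?thesis using has_integral_mult_left[OF integral_cos_int[of "k - l"], of "e k l"] by simp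
  qed
  then have "((\<lambda>w. \<Sum>k\<in>{0..int n}. \<Sum>l\<in>{0..int n}. cos (w * of_int (k - l)) * e k l) has_integral
     (\<Sum>k\<in>{0..int n}. \<Sum>l\<in>{0..int n}. if l = k then 2 * pi * e k l else 0)) {0..2 * pi}"
    by (intro has_integral_sum) auto
  then show ?thesis by (simp add: sum_distrib_left)
qed

section \<open>Second moments of the transform of a stationary process\<close>

lemma integrable_bilinear_of_sq_integrable:
  fixes f g :: "'a \<Rightarrow> real ^ 'm"
  assumes [measurable]: "f \<in> borel_measurable M" "g \<in> borel_measurable M"
    and sq: "integrable M (\<lambda>z. (norm (f z))\<^sup>2)" "integrable M (\<lambda>z. (norm (g z))\<^sup>2)"
  shows "integrable M (\<lambda>z. f z $ a * g z $ b)" "integrable M (\<lambda>z. f z \<bullet> g z)"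
proof -
  have bnd: "integrable M (\<lambda>z. (norm (f z))\<^sup>2 + (norm (g z))\<^sup>2)" using sq by simp
  have am: "norm (f z) * norm (g z) \<le> (norm (f z))\<^sup>2 + (norm (g z))\<^sup>2" for z
  proof -
    have "0 \<le> norm (f z) * norm (g z)" by simp
    then show ?thesis using sum_squares_bound[of "norm (f z)" "norm (g z)"] by linarith
  qed
  show "integrable M (\<lambda>z. f z $ a * g z $ b)"
  proof (rule Bochner_Integration.integrable_bound[OF bnd])
    have "norm (f z $ a * g z $ b) \<le> norm ((norm (f z))\<^sup>2 + (norm (g z))\<^sup>2)" for z
    proof -
      have "norm (f z $ a * g z $ b) \<le> norm (f z) * norm (g z)"
        unfolding norm_mult by (intro mult_mono Finite_Cartesian_Product.norm_nth_le) auto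
      then show ?thesis using am[of z] by simp
    qed
    then show "AE z in M. norm (f z $ a * g z $ b) \<le> norm ((norm (f z))\<^sup>2 + (norm (g z))\<^sup>2)" by simp
  qed (simp add: cart_eq_inner_axis)
  show "integrable M (\<lambda>z. f z \<bullet> g z)"
  proof (rule Bochner_Integration.integrable_bound[OF bnd])
    have "norm (f z \<bullet> g z) \<le> norm ((norm (f z))\<^sup>2 + (norm (g z))\<^sup>2)" for z
      using Cauchy_Schwarz_ineq2[of "f z" "g z"] am[of z] by simp
    then show "AE z in M. norm (f z \<bullet> g z) \<le> norm ((norm (f z))\<^sup>2 + (norm (g z))\<^sup>2)" by simp
  qed measurable
qed

definition spectrum_partial_sum ::
    "'a measure \<Rightarrow> (int \<Rightarrow> 'a \<Rightarrow> real ^ 'm) \<Rightarrow> real \<Rightarrow> nat \<Rightarrow> complex ^ 'm ^ 'm" where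
  "spectrum_partial_sum M x w n = (\<Sum>k\<in>{- int n..int n}.
     (\<chi> a b. complex_of_real (autocorr M x 0 k $ a $ b) * exp (- \<i> * complex_of_real w * of_int k)))"

text \<open>By stationarity the covariance between times \<open>k\<close> and \<open>l\<close> depends only on \<open>l - k\<close>, so the second
  moments of the transform are sums over lags, that is, \<open>n + 1\<close> times the Fejer mean of the series
  defining the power spectrum.\<close>

lemma expectation_dft_quadratic_form:
  fixes x :: "int \<Rightarrow> 'a \<Rightarrow> real ^ 'm"
  assumes meas: "\<And>k. x k \<in> borel_measurable M"
    and sq: "\<And>k. integrable M (\<lambda>z. (norm (x k z))\<^sup>2)" and stat: "stationary M x"
  shows "integrable M (\<lambda>z. dft n w (\<lambda>k. x k z) \<bullet> (G *v dft n w (\<lambda>k. x k z)))" (is ?int)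
    and "(LINT z|M. dft n w (\<lambda>k. x k z) \<bullet> (G *v dft n w (\<lambda>k. x k z))) =
       Re (trace (G ** (\<Sum>N\<le>n. spectrum_partial_sum M x w N)))" (is ?eq)
proof -
  note int = integrable_bilinear_of_sq_integrable(1)[OF meas meas sq sq]
  show ?int unfolding dft_quadratic_form by (intro Bochner_Integration.integrable_sum integrable_mult_right int)
  define c where "c j = (\<chi> a b. complex_of_real (autocorr M x 0 j $ a $ b) * exp (- \<i> * complex_of_real w * of_int j))" for j
  have c: "c (l - k) $ a $ b = complex_of_real (LINT z|M. x k z $ a * x l z $ b) * cis (w * of_int (k - l))" for k l a b
  proof -
    have "autocorr M x 0 (l - k) = autocorr M x k (l - k)" using stat by (auto simp: stationary_def)
    then have "autocorr M x 0 (l - k) $ a $ b = (LINT z|M. x k z $ a * x l z $ b)" by (simp add: autocorr_def)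
    moreover have "exp (- \<i> * complex_of_real w * of_int (l - k)) = cis (w * of_int (k - l))"
      by (simp add: cis_conv_exp algebra_simps)
    ultimately show ?thesis by (simp add: c_def)
  qed
  have partial: "spectrum_partial_sum M x w N = (\<Sum>j\<in>{- int N..int N}. c j)" for N
    by (simp only: spectrum_partial_sum_def c_def)
  have "Re (trace (G ** (\<Sum>N\<le>n. spectrum_partial_sum M x w N))) =
      Re (trace (G ** (\<Sum>k\<in>{0..int n}. \<Sum>l\<in>{0..int n}. c (l - k))))"
    unfolding sum_lags_eq_sum_partial_sums partial ..
  also have "\<dots> = (\<Sum>b\<in>UNIV. \<Sum>a\<in>UNIV. \<Sum>k\<in>{0..int n}. \<Sum>l\<in>{0..int n}. Re (G $ b $ a * c (l - k) $ a $ b))"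
    by (simp add: trace_def matrix_matrix_mult_def sum_distrib_left del: times_complex.sel)
  also have "\<dots> = (\<Sum>a\<in>UNIV. \<Sum>b\<in>UNIV. \<Sum>k\<in>{0..int n}. \<Sum>l\<in>{0..int n}. Re (G $ b $ a * c (l - k) $ a $ b))"
    by (rule sum.swap)
  also have "\<dots> = (\<Sum>k\<in>{0..int n}. \<Sum>l\<in>{0..int n}. \<Sum>a\<in>UNIV. \<Sum>b\<in>UNIV. Re (G $ b $ a * c (l - k) $ a $ b))"
    by (rule sum_swap_pairs)
  also have "\<dots> = (\<Sum>k\<in>{0..int n}. \<Sum>l\<in>{0..int n}. \<Sum>a\<in>UNIV. \<Sum>b\<in>UNIV.
      Re (G $ b $ a * cis (w * of_int (k - l))) * (LINT z|M. x k z $ a * x l z $ b))"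
    unfolding c by (intro sum.cong refl) (simp add: algebra_simps)
  also have "\<dots> = (LINT z|M. dft n w (\<lambda>k. x k z) \<bullet> (G *v dft n w (\<lambda>k. x k z)))"
    unfolding dft_quadratic_form
    by (simp add: Bochner_Integration.integral_sum Bochner_Integration.integrable_sum int)
  finally show ?eq by simp
qed

text \<open>Pointwise convergence of the symmetric partial sums implies convergence of their Cesaro means, so
  the normalised second moments of the transform converge to the power spectrum at every frequency.\<close>

lemma tendsto_expectation_dft_quadratic_form:
  fixes x :: "int \<Rightarrow> 'a \<Rightarrow> real ^ 'm"
  assumes "\<And>k. x k \<in> borel_measurable M"
    and "\<And>k. integrable M (\<lambda>z. (norm (x k z))\<^sup>2)" and "stationary M x"
    and \<Phi>: "has_power_spectrum M x \<Phi>"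
  shows "(\<lambda>n. (LINT z|M. dft n w (\<lambda>k. x k z) \<bullet> (G *v dft n w (\<lambda>k. x k z))) / real (n + 1))
    \<longlonglongrightarrow> Re (trace (G ** \<Phi> w))"
proof -
  let ?F = "\<lambda>n. (1 / real (n + 1)) *\<^sub>R (\<Sum>N\<le>n. spectrum_partial_sum M x w N)"
  have "spectrum_partial_sum M x w \<longlonglongrightarrow> \<Phi> w"
    using \<Phi> by (simp only: has_power_spectrum_def spectrum_partial_sum_def[abs_def])
  then have F: "?F \<longlonglongrightarrow> \<Phi> w"
    by (rule tendsto_cesaro_mean)
  have "(\<lambda>n. Re (trace (G ** ?F n))) \<longlonglongrightarrow> Re (trace (G ** \<Phi> w))"
    unfolding trace_def matrix_matrix_mult_def vec_lambda_beta
    by (intro tendsto_Re tendsto_sum tendsto_mult tendsto_const tendsto_vec_nth F)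
  moreover have "Re (trace (G ** ((1 / r) *\<^sub>R A))) = Re (trace (G ** A)) / r" for r and A :: "complex ^ 'm ^ 'm"
    unfolding scaleR_matrix_mult_right by (simp add: trace_def sum_divide_distrib)
  ultimately show ?thesis
    by (simp only: expectation_dft_quadratic_form(2)[OF assms(1-3)])
qed

lemma expectation_norm_dft_sq:
  fixes d :: "int \<Rightarrow> 'a \<Rightarrow> real ^ 'm"
  assumes meas: "\<And>k. d k \<in> borel_measurable Q" and sq: "\<And>k. integrable Q (\<lambda>z. (norm (d k z))\<^sup>2)"
  shows "integrable Q (\<lambda>z. (norm (dft n w (\<lambda>k. d k z)))\<^sup>2)"
    and "(LINT z|Q. (norm (dft n w (\<lambda>k. d k z)))\<^sup>2) =
      (\<Sum>k\<in>{0..int n}. \<Sum>l\<in>{0..int n}. cos (w * of_int (k - l)) * (LINT z|Q. d k z \<bullet> d l z))"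
proof -
  note int = integrable_bilinear_of_sq_integrable(2)[OF meas meas sq sq]
  show "integrable Q (\<lambda>z. (norm (dft n w (\<lambda>k. d k z)))\<^sup>2)"
    unfolding norm_dft_sq by (intro Bochner_Integration.integrable_sum integrable_mult_right int)
  show "(LINT z|Q. (norm (dft n w (\<lambda>k. d k z)))\<^sup>2) =
      (\<Sum>k\<in>{0..int n}. \<Sum>l\<in>{0..int n}. cos (w * of_int (k - l)) * (LINT z|Q. d k z \<bullet> d l z))"
    unfolding norm_dft_sq by (simp add: Bochner_Integration.integral_sum Bochner_Integration.integrable_sum int)
qed

definition mean_periodogram ::
    "'a measure \<Rightarrow> (int \<Rightarrow> 'a \<Rightarrow> real ^ 'm) \<Rightarrow> nat \<Rightarrow> real \<Rightarrow> real" where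
  "mean_periodogram Q d n w = (LINT z|Q. (norm (dft n w (\<lambda>k. d k z)))\<^sup>2) / (2 * pi * real (n + 1))"

text \<open>Parseval: over a full period the oscillating terms \<open>cos (w (k - l))\<close> with \<open>k \<noteq> l\<close> of the expanded
  square integrate to zero, and the diagonal terms add up to the mean energy in the time domain.\<close>

lemma nn_integral_mean_periodogram:
  fixes d :: "int \<Rightarrow> 'a \<Rightarrow> real ^ 'm"
  assumes meas: "\<And>k. d k \<in> borel_measurable Q" and sq: "\<And>k. integrable Q (\<lambda>z. (norm (d k z))\<^sup>2)"
  shows "mean_periodogram Q d n \<in> borel_measurable borel"
    and "(\<integral>\<^sup>+ w. ennreal (indicator {0..2 * pi} w * mean_periodogram Q d n w) \<partial>lborel) =
      (\<integral>\<^sup>+ z. ennreal (\<Sum>k\<in>{0..int n}. (norm (d k z))\<^sup>2) \<partial>Q) / of_nat (n + 1)"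
proof -
  have h: "mean_periodogram Q d n = (\<lambda>w. (\<Sum>k\<in>{0..int n}. \<Sum>l\<in>{0..int n}.
      cos (w * of_int (k - l)) * (LINT z|Q. d k z \<bullet> d l z)) / (2 * pi * real (n + 1)))"
    unfolding mean_periodogram_def[abs_def] expectation_norm_dft_sq(2)[OF meas sq] ..
  show hm: "mean_periodogram Q d n \<in> borel_measurable borel" unfolding h by measurable
  define f where "f w = indicator {0..2 * pi} w * mean_periodogram Q d n w" for w
  have fm: "f \<in> borel_measurable borel" unfolding f_def using hm by measurable
  define S where "S = (\<Sum>k\<in>{0..int n}. LINT z|Q. d k z \<bullet> d k z)"
  have "(mean_periodogram Q d n has_integral 2 * pi * S / (2 * pi * real (n + 1))) {0..2 * pi}"
    unfolding h S_def by (rule has_integral_divide[OF has_integral_trig_form])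
  then have "((\<lambda>w. if w \<in> {0..2 * pi} then mean_periodogram Q d n w else 0) has_integral
      2 * pi * S / (2 * pi * real (n + 1))) UNIV"
    by (simp only: has_integral_restrict_UNIV)
  then have "(f has_integral 2 * pi * S / (2 * pi * real (n + 1))) UNIV"
    by (rule has_integral_eq[rotated]) (simp add: f_def indicator_def)
  moreover have "0 \<le> f w" for w
    unfolding f_def mean_periodogram_def
    by (intro divide_nonneg_nonneg mult_nonneg_nonneg integral_nonneg_AE) auto
  ultimately have "(\<integral>\<^sup>+ w. ennreal (f w) \<partial>lborel) = ennreal (2 * pi * S / (2 * pi * real (n + 1)))"
    by (intro nn_integral_has_integral_lborel fm)
  also have "\<dots> = ennreal S / of_nat (n + 1)"
  proof -
    have "0 \<le> S" unfolding S_def by (intro sum_nonneg integral_nonneg_AE) auto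
    then show ?thesis
      by (simp add: divide_ennreal[symmetric] ennreal_of_nat_eq_real_of_nat del: of_nat_Suc of_nat_add)
  qed
  also have "ennreal S = (\<integral>\<^sup>+ z. ennreal (\<Sum>k\<in>{0..int n}. (norm (d k z))\<^sup>2) \<partial>Q)"
    unfolding S_def
    by (subst nn_integral_eq_integral)
       (use sq in \<open>auto intro!: sum_nonneg simp: dot_square_norm\<close>)
  finally show "(\<integral>\<^sup>+ w. ennreal (indicator {0..2 * pi} w * mean_periodogram Q d n w) \<partial>lborel) =
      (\<integral>\<^sup>+ z. ennreal (\<Sum>k\<in>{0..int n}. (norm (d k z))\<^sup>2) \<partial>Q) / of_nat (n + 1)"
    unfolding f_def .
qed

section \<open>The lower bound for couplings\<close>

text \<open>At a fixed frequency, the cost between the transforms dominates the sum of the two dual quadratic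
  forms that are optimal for the limiting spectra, and the expectations of these forms converge to
  the trace of \<open>W_mat\<close>.\<close>

lemma trace_W_mat_le_liminf:
  fixes X Y :: "int \<Rightarrow> 'a \<Rightarrow> real ^ 'm"
  assumes mX: "\<And>k. X k \<in> borel_measurable Q" and mY: "\<And>k. Y k \<in> borel_measurable Q"
    and sX: "\<And>k. integrable Q (\<lambda>z. (norm (X k z))\<^sup>2)" and sY: "\<And>k. integrable Q (\<lambda>z. (norm (Y k z))\<^sup>2)"
    and X: "stationary Q X" "has_power_spectrum Q X \<Phi>x" "hermitian_pos_def (\<Phi>x w)"
    and Y: "stationary Q Y" "has_power_spectrum Q Y \<Phi>y" "hermitian_pos_def (\<Phi>y w)"
    and D: "\<And>k. integrable Q (\<lambda>z. (norm (X k z - Y k z))\<^sup>2)"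
  shows "ennreal (Re (trace (W_mat (\<Phi>x w) (\<Phi>y w))) / (2 * pi)) \<le>
    liminf (\<lambda>n. ennreal (mean_periodogram Q (\<lambda>k z. X k z - Y k z) n w))"
proof -
  obtain G H :: "complex ^ 'm ^ 'm" where
    GH: "\<And>u v. u \<bullet> (G *v u) + v \<bullet> (H *v v) \<le> (norm (u - v))\<^sup>2"
    and W: "trace (W_mat (\<Phi>x w) (\<Phi>y w)) = trace (G ** \<Phi>x w) + trace (H ** \<Phi>y w)"
    using trace_W_mat_dual[OF X(3) Y(3)] by blast
  define g where "g n = (LINT z|Q. dft n w (\<lambda>k. X k z) \<bullet> (G *v dft n w (\<lambda>k. X k z))) / real (n + 1)
      + (LINT z|Q. dft n w (\<lambda>k. Y k z) \<bullet> (H *v dft n w (\<lambda>k. Y k z))) / real (n + 1)" for n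
  have "g \<longlonglongrightarrow> Re (trace (G ** \<Phi>x w)) + Re (trace (H ** \<Phi>y w))"
    unfolding g_def
    by (intro tendsto_add tendsto_expectation_dft_quadratic_form[OF mX sX X(1,2)]
        tendsto_expectation_dft_quadratic_form[OF mY sY Y(1,2)])
  then have "(\<lambda>n. ennreal (g n / (2 * pi))) \<longlonglongrightarrow> ennreal (Re (trace (W_mat (\<Phi>x w) (\<Phi>y w))) / (2 * pi))"
    unfolding W plus_complex.sel by (intro tendsto_ennrealI tendsto_divide tendsto_const) auto
  then have "ennreal (Re (trace (W_mat (\<Phi>x w) (\<Phi>y w))) / (2 * pi)) = liminf (\<lambda>n. ennreal (g n / (2 * pi)))"
    by (simp add: lim_imp_Liminf)
  also have "\<dots> \<le> liminf (\<lambda>n. ennreal (mean_periodogram Q (\<lambda>k z. X k z - Y k z) n w))"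
  proof (intro Liminf_mono always_eventually allI ennreal_leI)
    fix n
    have "g n = (LINT z|Q. dft n w (\<lambda>k. X k z) \<bullet> (G *v dft n w (\<lambda>k. X k z))
        + dft n w (\<lambda>k. Y k z) \<bullet> (H *v dft n w (\<lambda>k. Y k z))) / real (n + 1)"
      unfolding g_def
      by (subst Bochner_Integration.integral_add)
         (intro expectation_dft_quadratic_form(1) mX mY sX sY X Y | simp add: add_divide_distrib)+
    also have "\<dots> \<le> (LINT z|Q. (norm (dft n w (\<lambda>k. X k z - Y k z)))\<^sup>2) / real (n + 1)"
      using GH mX mY
      by (intro divide_right_mono integral_mono Bochner_Integration.integrable_add
          expectation_dft_quadratic_form(1) expectation_norm_dft_sq(1) mX mY sX sY X Y D)
         (auto simp: dft_diff[symmetric])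
    finally have "g n / (2 * pi) \<le> (LINT z|Q. (norm (dft n w (\<lambda>k. X k z - Y k z)))\<^sup>2) / real (n + 1) / (2 * pi)"
      by (rule divide_right_mono) simp
    then show "g n / (2 * pi) \<le> mean_periodogram Q (\<lambda>k z. X k z - Y k z) n w"
      by (simp add: mean_periodogram_def mult.commute)
  qed
  finally show ?thesis .
qed

text \<open>When \<open>g\<close> is not integrable, in particular when it is not measurable, the left-hand side is zero by
  convention.\<close>

lemma ennreal_integral_le_nn_integral:
  fixes g :: "'a \<Rightarrow> real"
  shows "ennreal (integral\<^sup>L M g) \<le> (\<integral>\<^sup>+ z. ennreal (g z) \<partial>M)"
proof (cases "integrable M g")
  case True
  then have "ennreal (integral\<^sup>L M g) \<le> ennreal (LINT z|M. max 0 (g z))"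
    by (intro ennreal_leI integral_mono) auto
  also have "\<dots> = (\<integral>\<^sup>+ z. ennreal (max 0 (g z)) \<partial>M)"
    using True by (intro nn_integral_eq_integral[symmetric]) auto
  finally show ?thesis by simp
next
  case False
  then show ?thesis by (simp add: not_integrable_integral_eq)
qed

lemma sq_integrable_diff:
  fixes f g :: "'a \<Rightarrow> real ^ 'm"
  assumes [measurable]: "f \<in> borel_measurable M" "g \<in> borel_measurable M"
    and "integrable M (\<lambda>z. (norm (f z))\<^sup>2)" "integrable M (\<lambda>z. (norm (g z))\<^sup>2)"
  shows "integrable M (\<lambda>z. (norm (f z - g z))\<^sup>2)"
proof -
  have "(norm (f z - g z))\<^sup>2 = (norm (f z))\<^sup>2 + (norm (g z))\<^sup>2 - 2 * (f z \<bullet> g z)" for z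
    by (simp add: power2_norm_eq_inner inner_diff_left inner_diff_right inner_commute)
  then show ?thesis
    using assms integrable_bilinear_of_sq_integrable(2)[OF assms] by simp
qed

text \<open>Parseval turns the cost over the first \<open>n + 1\<close> times into an integral over frequencies, and Fatou's
  lemma allows the pointwise lower bound to be integrated in the limit.\<close>

lemma spectral_lower_bound_le_avg_cost:
  fixes X Y :: "int \<Rightarrow> 'a \<Rightarrow> real ^ 'm"
  assumes mX: "\<And>k. X k \<in> borel_measurable Q" and mY: "\<And>k. Y k \<in> borel_measurable Q"
    and sX: "\<And>k. integrable Q (\<lambda>z. (norm (X k z))\<^sup>2)" and sY: "\<And>k. integrable Q (\<lambda>z. (norm (Y k z))\<^sup>2)"
    and X: "stationary Q X" "has_power_spectrum Q X \<Phi>x" "\<And>w. hermitian_pos_def (\<Phi>x w)"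
    and Y: "stationary Q Y" "has_power_spectrum Q Y \<Phi>y" "\<And>w. hermitian_pos_def (\<Phi>y w)"
  shows "ennreal (1 / (2 * pi) * (LINT w:{0..2 * pi}|lborel. Re (trace (W_mat (\<Phi>x w) (\<Phi>y w))))) \<le> avg_cost Q X Y"
proof -
  have sD: "integrable Q (\<lambda>z. (norm (X k z - Y k z))\<^sup>2)" for k
    by (rule sq_integrable_diff[OF mX mY sX sY])
  have mD: "(\<lambda>z. X k z - Y k z) \<in> borel_measurable Q" for k
    using mX mY by measurable
  define t where "t w = Re (trace (W_mat (\<Phi>x w) (\<Phi>y w))) / (2 * pi)" for w
  define f where "f n w = indicator {0..2 * pi} w * mean_periodogram Q (\<lambda>k z. X k z - Y k z) n w" for n w
  note periodogram = nn_integral_mean_periodogram[OF mD sD]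
  have fm: "f n \<in> borel_measurable borel" for n
    unfolding f_def[abs_def] using periodogram(1) by measurable
  have "1 / (2 * pi) * (LINT w:{0..2 * pi}|lborel. Re (trace (W_mat (\<Phi>x w) (\<Phi>y w)))) =
      (LINT w|lborel. indicator {0..2 * pi} w * t w)"
    by (simp add: set_lebesgue_integral_def t_def)
  then have "ennreal (1 / (2 * pi) * (LINT w:{0..2 * pi}|lborel. Re (trace (W_mat (\<Phi>x w) (\<Phi>y w))))) \<le>
      (\<integral>\<^sup>+ w. ennreal (indicator {0..2 * pi} w * t w) \<partial>lborel)"
    by (simp only: ennreal_integral_le_nn_integral)
  also have "\<dots> \<le> (\<integral>\<^sup>+ w. liminf (\<lambda>n. ennreal (f n w)) \<partial>lborel)"
  proof (rule nn_integral_mono)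
    fix w
    show "ennreal (indicator {0..2 * pi} w * t w) \<le> liminf (\<lambda>n. ennreal (f n w))"
      using trace_W_mat_le_liminf[OF mX mY sX sY X Y sD, of w]
      by (cases "w \<in> {0..2 * pi}") (simp_all add: f_def t_def)
  qed
  also have "\<dots> \<le> liminf (\<lambda>n. \<integral>\<^sup>+ w. ennreal (f n w) \<partial>lborel)"
    using fm by (intro nn_integral_liminf) simp
  also have "\<dots> = liminf (\<lambda>n. (\<integral>\<^sup>+ z. ennreal (\<Sum>k\<in>{0..int n}. (norm (X k z - Y k z))\<^sup>2) \<partial>Q) / of_nat (n + 1))"
    unfolding f_def periodogram(2) ..
  also have "\<dots> \<le> avg_cost Q X Y"
    unfolding avg_cost_def by (rule Liminf_le_Limsup) simp
  finally show ?thesis .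
qed

lemma measurable_process_path:
  assumes "process M x"
  shows "(\<lambda>z k. x k z) \<in> M \<rightarrow>\<^sub>M path_space"
  by (rule measurable_PiM_single') (use assms in \<open>auto simp: process_def\<close>)

lemma process_law_eq_transfer:
  fixes x :: "int \<Rightarrow> 'a \<Rightarrow> real ^ 'm" and X :: "int \<Rightarrow> 'b \<Rightarrow> real ^ 'm"
  assumes law: "process_law Q X = process_law M x" and X: "process Q X" and x: "process M x"
    and g: "g \<in> borel_measurable path_space"
  shows "integrable Q (\<lambda>z. g (\<lambda>k. X k z)) \<longleftrightarrow> integrable M (\<lambda>z. g (\<lambda>k. x k z))"
    and "(LINT z|Q. g (\<lambda>k. X k z)) = (LINT z|M. g (\<lambda>k. x k z) :: real)"
proof -
  note mX = measurable_process_path[OF X] and mx = measurable_process_path[OF x]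
  show "integrable Q (\<lambda>z. g (\<lambda>k. X k z)) \<longleftrightarrow> integrable M (\<lambda>z. g (\<lambda>k. x k z))"
    using integrable_distr_eq[OF mX g] integrable_distr_eq[OF mx g] law by (simp add: process_law_def)
  show "(LINT z|Q. g (\<lambda>k. X k z)) = (LINT z|M. g (\<lambda>k. x k z))"
    using integral_distr[OF mX g] integral_distr[OF mx g] law by (simp add: process_law_def)
qed

text \<open>Each marginal of a coupling has the law of the given process, hence the same second moments and
  the same power spectrum.\<close>

lemma second_order_transfer:
  fixes x :: "int \<Rightarrow> 'a \<Rightarrow> real ^ 'm" and X :: "int \<Rightarrow> 'b \<Rightarrow> real ^ 'm"
  assumes law: "process_law Q X = process_law M x" and X: "process Q X" and x: "zero_mean_process M x"
  shows "\<And>k. X k \<in> borel_measurable Q" "\<And>k. integrable Q (\<lambda>z. (norm (X k z))\<^sup>2)"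
    and "autocorr Q X = autocorr M x"
proof -
  have px: "process M x" and sq: "\<And>k. integrable M (\<lambda>z. (norm (x k z))\<^sup>2)"
    using x by (auto simp: zero_mean_process_def)
  note tr = process_law_eq_transfer[OF law X px]
  show "X k \<in> borel_measurable Q" for k using X by (simp add: process_def)
  show "integrable Q (\<lambda>z. (norm (X k z))\<^sup>2)" for k
    using tr(1)[of "\<lambda>p. (norm (p k))\<^sup>2"] sq by simp
  have "(LINT z|Q. X i z $ a * X j z $ b) = (LINT z|M. x i z $ a * x j z $ b)" for i j a b
    by (rule tr(2)[of "\<lambda>p. p i $ a * p j $ b"]) (simp add: cart_eq_inner_axis)
  then show "autocorr Q X = autocorr M x"
    by (simp add: autocorr_def fun_eq_iff)
qed

lemma sqrt_ennreal_ennreal: "sqrt_ennreal (ennreal c) = ennreal (sqrt c)"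
  by (cases "0 \<le> c") (auto simp: sqrt_ennreal_def ennreal_neg)

theorem corollary1:
  fixes M :: "'a measure" and N :: "'b measure"
    and x :: "int \<Rightarrow> 'a \<Rightarrow> real ^ 'm" and y :: "int \<Rightarrow> 'b \<Rightarrow> real ^ 'm"
    and px py :: "(int \<Rightarrow> real ^ 'm) measure"
    and \<Phi>x \<Phi>y :: "real \<Rightarrow> complex ^ 'm ^ 'm"
  assumes "zero_mean_process M x" and "zero_mean_process N y"
    and "has_densities M x" and "has_densities N y"
    and "stationary M x" and "stationary N y"
    and "px = process_law M x" and "py = process_law N y"
    and "has_power_spectrum M x \<Phi>x" and "has_power_spectrum N y \<Phi>y"
    and "covs_pos_def M x" and "covs_pos_def N y"
    and "\<forall>w. hermitian_pos_def (\<Phi>x w)" and "\<forall>w. hermitian_pos_def (\<Phi>y w)"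
  shows "avg_W2 px py \<ge>
    ennreal (sqrt (1 / (2 * pi) * (LINT w:{0..2 * pi}|lborel. Re (trace (W_mat (\<Phi>x w) (\<Phi>y w))))))"
proof -
  let ?B = "1 / (2 * pi) * (LINT w:{0..2 * pi}|lborel. Re (trace (W_mat (\<Phi>x w) (\<Phi>y w))))"
  have "ennreal ?B \<le> avg_cost Q X Y" if cpl: "is_coupling Q X Y px py"
    for Q :: "((int \<Rightarrow> real ^ 'm) \<times> (int \<Rightarrow> real ^ 'm)) measure" and X Y
  proof -
    have "process_law Q X = process_law M x" "process Q X" "process_law Q Y = process_law N y" "process Q Y"
      using cpl assms(7,8) by (simp_all add: is_coupling_def)
    note X = second_order_transfer[OF this(1,2) assms(1)] and Y = second_order_transfer[OF this(3,4) assms(2)]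
    show ?thesis
    proof (rule spectral_lower_bound_le_avg_cost[OF X(1) Y(1) X(2) Y(2)])
      show "stationary Q X" "stationary Q Y"
        using assms(5,6) by (simp_all add: stationary_def X(3) Y(3))
      show "has_power_spectrum Q X \<Phi>x" "has_power_spectrum Q Y \<Phi>y"
        using assms(9,10) by (simp_all add: has_power_spectrum_def X(3) Y(3))
    qed (use assms(13,14) in auto)
  qed
  then have "ennreal ?B \<le> (INF (Q, X, Y) \<in> {(Q :: ((int \<Rightarrow> real ^ 'm) \<times> (int \<Rightarrow> real ^ 'm)) measure, X, Y).
      is_coupling Q X Y px py}. avg_cost Q X Y)"
    by (intro INF_greatest) auto
  from sqrt_ennreal_mono[OF this] show ?thesis
    by (simp only: sqrt_ennreal_ennreal avg_W2_def)
qed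

end
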